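(* Let $X$ be a finite set with $|X|=m\ge 1$, let $k\ge 1$ be an integer, let $a\in X$, and let $\mathrel{|}$ be the incidence relation of the combinatorial Veronesian $\mathbf V_k(X)$. Put $$\mathcal X_2=\{f\in\mathfrak y_k(X)\colon a\in\mathrm{supp}(f)\},\qquad \mathcal X_1=\mathfrak y_k(X\setminus\{a\}),$$ $$\mathcal L_2=\{e\in\mathfrak y_{<k}(X)\colon a\in\mathrm{supp}(e)\},\qquad \mathcal L_1=\mathfrak y_{<k}(X\setminus\{a\}).$$ For $f\in\mathcal X_2$ let $f^\infty=f/a^{dg(a,f)}\in\mathcal L_1$, where $dg(a,f)$ is the greatest integer $s$ such that $f=a^s g$ for a multiset $g$. Then the dual of $\mathbf V_k(X)$ satisfies $$\mathbf V_k(X)^\circ=\langle\mathcal L_2,\mathcal X_2,\mathrel{|}^{-1}\rangle\rtimes_\infty\langle\mathcal L_1,\mathcal X_1,\mathrel{|}^{-1}\rangle\;\cong\;\mathbf V_{k-1}(X)^\circ\rtimes_\infty\mathbf V_k(X\setminus\{a\})^\circ,$$ where in the two structures $\langle\mathcal L_i,\mathcal X_i,\mathrel{|}^{-1}\rangle$ the incidence is restricted to $\mathcal L_i\times\mathcal X_i$, and the last isomorphism is the one arising from isomorphisms $\langle\mathcal L_2,\mathcal X_2,\mathrel{|}^{-1}\rangle\cong\mathbf V_{k-1}(X)^\circ$ and $\langle\mathcal L_1,\mathcal X_1,\mathrel{|}^{-1}\rangle\cong\mathbf V_k(X\setminus\{a\})^\circ$ of the respective components (taken as disjoint copies), along which $\infty$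 is transported.
   Context: An incidence structure $\mathfrak K=\langle U,\mathcal L,\mathrel{|}\rangle$ consists of a set $U$ of points, a set $\mathcal L$ of lines and an incidence relation $\mathrel{|}\subset U\times\mathcal L$. It is a partial linear space if, whenever points $p,q$ are both incident with lines $A,B$, then $p=q$ or $A=B$. The dual of $\mathfrak K$ is $\mathfrak K^\circ=\langle\mathcal L,U,\mathrel{|}^{-1}\rangle$ (points are the lines of $\mathfrak K$, lines are the points of $\mathfrak K$). The dual of a partial linear space is a partial linear space. A multiset over a finite set $X$ is a function $f\colon X\to\{0,1,2,\dots\}$, written multiplicatively as $f=\prod_{x\in X}x^{f(x)}$ (so the product of multisets is the pointwise sum of functions, and $1$ is the zero function). Its cardinality is $|f|=\sum_{x\in X}f(x)$ and $\mathrm{supp}(f)=\{x\in X\colon f(x)>0\}$. A multiset over $X\setminus\{a\}$ is regarded as a multiset over $X$ whose support does not contain $a$. Let $\mathfrak y_k(X)$ be the set of multisets over $X$ of cardinality $k$ and $\mathfrak y_{<k}(X)=\bigcup_{i=0}^{k-1}\mathfrak y_i(X)$. The combinatorial Veronesian $\mathbf V_k(X)$ is the incidence structure with point set $\mathfrak y_k(X)$, line set $\mathfrak y_{<k}(X)$, in which a point $f$ is incident with a line $e$ iff $f=e\,x^{k-|e|}$ for some $x\in X$. It is a partial linear space. Given partial linear spaces $\mathfrak K_i=\langle U_i,\mathcal L_i,\mathrel{|_i}\rangle$, $i=1,2$, with $U_1\cap U_2=\emptyset=\mathcal L_1\cap\mathcal L_2$, and a map $\infty\colon\mathcal L_1\to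 U_2$, $A\mapsto A^\infty$, such that two lines $A,B\in\mathcal L_1$ which have a common point in $U_1$ and satisfy $A^\infty=B^\infty$ are equal, the structure $\mathfrak K_1\rtimes_\infty\mathfrak K_2$ is $\langle U_1\cup U_2,\ \mathcal L_1\cup\mathcal L_2,\ \mathrel{|_1}\cup\mathrel{|_2}\cup\{(A^\infty,A)\colon A\in\mathcal L_1\}\rangle$. (Here the symbols $U_i,\mathcal L_i$ refer to this general definition only; in the claim, the first component has point set $\{e\in\mathfrak y_{<k}(X)\colon a\in\mathrm{supp}(e)\}$ and line set $\{f\in\mathfrak y_k(X)\colon a\in\mathrm{supp}(f)\}$.) *)

theory Defs
  imports "HOL-Library.Multiset"
begin

record ('p, 'l) incidence =
  Points :: "'p set"
  Lines :: "'l set"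
  Inc :: "('p \<times> 'l) set"

definition incidence_structure :: "('p, 'l) incidence \<Rightarrow> bool" where
  "incidence_structure K \<longleftrightarrow> Inc K \<subseteq> Points K \<times> Lines K"

definition partial_linear_space :: "('p, 'l) incidence \<Rightarrow> bool" where
  "partial_linear_space K \<longleftrightarrow> incidence_structure K \<and>
     (\<forall>p\<in>Points K. \<forall>q\<in>Points K. \<forall>A\<in>Lines K. \<forall>B\<in>Lines K.
        (p, A) \<in> Inc K \<and> (q, A) \<in> Inc K \<and> (p, B) \<in> Inc K \<and> (q, B) \<in> Inc K
        \<longrightarrow> p = q \<or> A = B)"

definition dual :: "('p, 'l) incidence \<Rightarrow> ('l, 'p) incidence" where
  "dual K = \<lparr>Points = Lines K, Lines = Points K, Inc = (Inc K)\<inverse>\<rparr>"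

definition incidence_iso ::
  "('p \<Rightarrow> 'q) \<Rightarrow> ('l \<Rightarrow> 'm) \<Rightarrow> ('p, 'l) incidence \<Rightarrow> ('q, 'm) incidence \<Rightarrow> bool" where
  "incidence_iso \<phi> \<psi> K K' \<longleftrightarrow>
     bij_betw \<phi> (Points K) (Points K') \<and> bij_betw \<psi> (Lines K) (Lines K') \<and>
     (\<forall>p\<in>Points K. \<forall>A\<in>Lines K. (p, A) \<in> Inc K \<longleftrightarrow> (\<phi> p, \<psi> A) \<in> Inc K')"

definition relabel ::
  "('p \<Rightarrow> 'q) \<Rightarrow> ('l \<Rightarrow> 'm) \<Rightarrow> ('p, 'l) incidence \<Rightarrow> ('q, 'm) incidence" where
  "relabel \<phi> \<psi> K =
     \<lparr>Points = \<phi> ` Points K, Lines = \<psi> ` Lines K, Inc = map_prod \<phi> \<psi> ` Inc K\<rparr>"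

text \<open>
  \<open>glue\<close> is the operation $\rtimes_\infty$. It is a total function here; the side conditions under
  which the operation is defined are collected in \<open>glueable\<close>. Only the values of \<open>\<iota>\<close> (the map
  $\infty$) on the lines of the first structure matter.
\<close>

definition glueable ::
  "('p, 'l) incidence \<Rightarrow> ('l \<Rightarrow> 'p) \<Rightarrow> ('p, 'l) incidence \<Rightarrow> bool" where
  "glueable K\<^sub>1 \<iota> K\<^sub>2 \<longleftrightarrow>
     partial_linear_space K\<^sub>1 \<and> partial_linear_space K\<^sub>2 \<and>
     Points K\<^sub>1 \<inter> Points K\<^sub>2 = {} \<and> Lines K\<^sub>1 \<inter> Lines K\<^sub>2 = {} \<and>
     (\<forall>A\<in>Lines K\<^sub>1. \<iota> A \<in> Points K\<^sub>2) \<and>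
     (\<forall>A\<in>Lines K\<^sub>1. \<forall>B\<in>Lines K\<^sub>1.
        (\<exists>p\<in>Points K\<^sub>1. (p, A) \<in> Inc K\<^sub>1 \<and> (p, B) \<in> Inc K\<^sub>1) \<and> \<iota> A = \<iota> B \<longrightarrow> A = B)"

definition glue ::
  "('p, 'l) incidence \<Rightarrow> ('l \<Rightarrow> 'p) \<Rightarrow> ('p, 'l) incidence \<Rightarrow> ('p, 'l) incidence" where
  "glue K\<^sub>1 \<iota> K\<^sub>2 =
     \<lparr>Points = Points K\<^sub>1 \<union> Points K\<^sub>2, Lines = Lines K\<^sub>1 \<union> Lines K\<^sub>2,
      Inc = Inc K\<^sub>1 \<union> Inc K\<^sub>2 \<union> {(\<iota> A, A) | A. A \<in> Lines K\<^sub>1}\<rparr>"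

text \<open>
  Transport of \<open>\<iota>\<close> along a map \<open>\<psi>\<close>, injective on the line set \<open>L\<close>, and a map \<open>\<phi>\<close> on points: the line
  \<open>\<psi> A\<close> is sent to \<open>\<phi> (\<iota> A)\<close> for every \<open>A \<in> L\<close>.
\<close>

definition transport ::
  "'l set \<Rightarrow> ('l \<Rightarrow> 'm) \<Rightarrow> ('p \<Rightarrow> 'q) \<Rightarrow> ('l \<Rightarrow> 'p) \<Rightarrow> 'm \<Rightarrow> 'q" where
  "transport L \<psi> \<phi> \<iota> B = \<phi> (\<iota> (inv_into L \<psi> B))"

text \<open>
  A multiset over \<open>X\<close> is a library multiset with support contained in \<open>X\<close>. In the multiplicative
  notation, the product is \<open>+\<close>, the power $x^n$ is \<open>replicate_mset n x\<close>, the unit is the empty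
  multiset, and division is \<open>-\<close> on multisets.
\<close>

definition msets :: "nat \<Rightarrow> 'a set \<Rightarrow> 'a multiset set" where
  "msets k X = {f. set_mset f \<subseteq> X \<and> size f = k}"

definition msets_less :: "nat \<Rightarrow> 'a set \<Rightarrow> 'a multiset set" where
  "msets_less k X = (\<Union>i<k. msets i X)"

definition veronesian :: "nat \<Rightarrow> 'a set \<Rightarrow> ('a multiset, 'a multiset) incidence" where
  "veronesian k X =
     \<lparr>Points = msets k X, Lines = msets_less k X,
      Inc = {(f, e). f \<in> msets k X \<and> e \<in> msets_less k X \<and>
                     (\<exists>x\<in>X. f = e + replicate_mset (k - size e) x)}\<rparr>"

definition dg :: "'a \<Rightarrow> 'a multiset \<Rightarrow> nat" where
  "dg a f = (GREATEST s. \<exists>g. f = replicate_mset s a + g)"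

definition infty :: "'a \<Rightarrow> 'a multiset \<Rightarrow> 'a multiset" where
  "infty a f = f - replicate_mset (dg a f) a"

end

theory Submission imports Defs begin

text \<open>
  Two distinct points \<open>p\<close>, \<open>q\<close> on a line \<open>e\<close> of the Veronesian satisfy \<open>p \<inter># q = e\<close>, so they
  determine \<open>e\<close>. A line containing \<open>a\<close> has only points containing \<open>a\<close>; a point \<open>f\<close> containing \<open>a\<close>
  lies on exactly one line not containing \<open>a\<close>, namely \<open>infty a f\<close>, which is \<open>f\<close> with every \<open>a\<close>
  deleted. Hence two such points with the same \<open>infty\<close> and a common line containing \<open>a\<close> share two
  lines and are equal. Cancelling a single \<open>a\<close> identifies the part of the structure containing \<open>a\<close>
  with the Veronesian of level \<open>k - 1\<close>, because it preserves the exponent \<open>k - size e\<close>.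
\<close>

section \<open>Isomorphisms, relabelling and gluing of incidence structures\<close>

lemma incidence_iso_partial_linear_space:
  assumes iso: "incidence_iso \<phi> \<psi> K K'" and inc: "incidence_structure K'"
    and pls: "partial_linear_space K"
  shows "partial_linear_space K'"
  unfolding partial_linear_space_def
proof (intro conjI ballI impI)
  have P: "Points K' = \<phi> ` Points K" and L: "Lines K' = \<psi> ` Lines K"
    using iso by (auto simp: incidence_iso_def bij_betw_def)
  fix p q A B
  assume "p \<in> Points K'" "q \<in> Points K'" "A \<in> Lines K'" "B \<in> Lines K'"
    and I: "(p, A) \<in> Inc K' \<and> (q, A) \<in> Inc K' \<and> (p, B) \<in> Inc K' \<and> (q, B) \<in> Inc K'"
  then obtain p' q' A' B' where *: "p = \<phi> p'" "q = \<phi> q'" "A = \<psi> A'" "B = \<psi> B'"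
    and m: "p' \<in> Points K" "q' \<in> Points K" "A' \<in> Lines K" "B' \<in> Lines K"
    unfolding P L by blast
  with I iso have "(p', A') \<in> Inc K" "(q', A') \<in> Inc K" "(p', B') \<in> Inc K" "(q', B') \<in> Inc K"
    by (auto simp: incidence_iso_def)
  with pls m have "p' = q' \<or> A' = B'"
    unfolding partial_linear_space_def by blast
  with * show "p = q \<or> A = B" by blast
\<comment> \<open>\<open>incidence_iso\<close> compares incidence only on points and lines, so it
  cannot exclude stray pairs from \<open>Inc K'\<close>.\<close>
qed (fact inc)

lemma incidence_iso_comp:
  assumes "incidence_iso \<phi> \<psi> K K'" and "incidence_iso \<phi>' \<psi>' K' K''"
  shows "incidence_iso (\<phi>' \<circ> \<phi>) (\<psi>' \<circ> \<psi>) K K''"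
  using assms unfolding incidence_iso_def
  by (auto intro: bij_betw_trans simp: bij_betw_apply)

text \<open>Injectivity on the whole types lets every incidence of the image be pulled back, even if
  \<open>Inc K\<close> has pairs outside its points and lines.\<close>

lemma incidence_iso_relabel:
  assumes "inj \<phi>" and "inj \<psi>"
  shows "incidence_iso \<phi> \<psi> K (relabel \<phi> \<psi> K)"
  using assms unfolding incidence_iso_def relabel_def bij_betw_def
  by (auto simp: inj_on_def inj_def)

lemma incidence_structure_relabel:
  assumes "incidence_structure K"
  shows "incidence_structure (relabel \<phi> \<psi> K)"
  using assms unfolding incidence_structure_def relabel_def by auto

lemma transport_apply:
  assumes "inj_on \<psi> L" and "A \<in> L"
  shows "transport L \<psi> \<phi> \<iota> (\<psi> A) = \<phi> (\<iota> A)"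
  using assms by (simp add: transport_def)

text \<open>A common point pulls back along \<open>iso\<^sub>1\<close>, and equal transported values
  pull back because \<open>\<phi>\<^sub>2\<close> is injective on \<open>Points K\<^sub>2\<close>.
  Disjointness of the images is assumed, since the two isomorphisms are chosen
  independently.\<close>

lemma glueable_transport:
  assumes g: "glueable K\<^sub>1 \<iota> K\<^sub>2"
    and iso\<^sub>1: "incidence_iso \<phi>\<^sub>1 \<psi>\<^sub>1 K\<^sub>1 V\<^sub>1" and iso\<^sub>2: "incidence_iso \<phi>\<^sub>2 \<psi>\<^sub>2 K\<^sub>2 V\<^sub>2"
    and inc: "incidence_structure V\<^sub>1" "incidence_structure V\<^sub>2"
    and disj: "Points V\<^sub>1 \<inter> Points V\<^sub>2 = {}" "Lines V\<^sub>1 \<inter> Lines V\<^sub>2 = {}"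
  shows "glueable V\<^sub>1 (transport (Lines K\<^sub>1) \<psi>\<^sub>1 \<phi>\<^sub>2 \<iota>) V\<^sub>2"
proof -
  let ?\<iota> = "transport (Lines K\<^sub>1) \<psi>\<^sub>1 \<phi>\<^sub>2 \<iota>"
  have L\<^sub>1: "Lines V\<^sub>1 = \<psi>\<^sub>1 ` Lines K\<^sub>1" and P\<^sub>1: "Points V\<^sub>1 = \<phi>\<^sub>1 ` Points K\<^sub>1"
    and P\<^sub>2: "Points V\<^sub>2 = \<phi>\<^sub>2 ` Points K\<^sub>2"
    and inj: "inj_on \<psi>\<^sub>1 (Lines K\<^sub>1)" "inj_on \<phi>\<^sub>2 (Points K\<^sub>2)"
    using iso\<^sub>1 iso\<^sub>2 by (auto simp: incidence_iso_def bij_betw_def)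
  have t: "?\<iota> (\<psi>\<^sub>1 A) = \<phi>\<^sub>2 (\<iota> A)" if "A \<in> Lines K\<^sub>1" for A
    using transport_apply[OF inj(1) that] .
  have \<iota>: "\<iota> A \<in> Points K\<^sub>2" if "A \<in> Lines K\<^sub>1" for A
    using g that by (auto simp: glueable_def)
  have "A = B" if that': "A \<in> Lines V\<^sub>1" "B \<in> Lines V\<^sub>1" "p \<in> Points V\<^sub>1"
      "(p, A) \<in> Inc V\<^sub>1" "(p, B) \<in> Inc V\<^sub>1" "?\<iota> A = ?\<iota> B" for A B p
  proof -
    obtain A' B' p' where *: "A = \<psi>\<^sub>1 A'" "B = \<psi>\<^sub>1 B'" "p = \<phi>\<^sub>1 p'"
      and m: "A' \<in> Lines K\<^sub>1" "B' \<in> Lines K\<^sub>1" "p' \<in> Points K\<^sub>1"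
      using that'(1-3) L\<^sub>1 P\<^sub>1 by blast
    have "(p', A') \<in> Inc K\<^sub>1" "(p', B') \<in> Inc K\<^sub>1"
      using that'(4,5) iso\<^sub>1 m * by (auto simp: incidence_iso_def)
    moreover have "\<iota> A' = \<iota> B'"
      using that'(6) m * \<iota> inj(2) by (auto simp: t inj_on_eq_iff)
    ultimately have "A' = B'"
      using g m unfolding glueable_def by blast
    with * show ?thesis by simp
  qed
  moreover have "?\<iota> A \<in> Points V\<^sub>2" if "A \<in> Lines V\<^sub>1" for A
    using that \<iota> by (auto simp: L\<^sub>1 P\<^sub>2 t)
  ultimately show ?thesis
    using g disj incidence_iso_partial_linear_space[OF iso\<^sub>1 inc(1)]
      incidence_iso_partial_linear_space[OF iso\<^sub>2 inc(2)]
    unfolding glueable_def by blast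
qed

text \<open>Disjointness makes the piecewise maps bijective. Incidence is then compared block by
  block: the diagonal blocks come from the given isomorphisms, one mixed block is governed by
  \<open>\<iota>\<close>, and the other is empty.\<close>

lemma incidence_iso_glue:
  assumes g: "glueable K\<^sub>1 \<iota> K\<^sub>2"
    and iso\<^sub>1: "incidence_iso \<phi>\<^sub>1 \<psi>\<^sub>1 K\<^sub>1 V\<^sub>1" and iso\<^sub>2: "incidence_iso \<phi>\<^sub>2 \<psi>\<^sub>2 K\<^sub>2 V\<^sub>2"
    and inc: "incidence_structure V\<^sub>1" "incidence_structure V\<^sub>2"
    and disj: "Points V\<^sub>1 \<inter> Points V\<^sub>2 = {}" "Lines V\<^sub>1 \<inter> Lines V\<^sub>2 = {}"
  shows "incidence_iso
    (\<lambda>p. if p \<in> Points K\<^sub>1 then \<phi>\<^sub>1 p else \<phi>\<^sub>2 p)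
    (\<lambda>A. if A \<in> Lines K\<^sub>1 then \<psi>\<^sub>1 A else \<psi>\<^sub>2 A)
    (glue K\<^sub>1 \<iota> K\<^sub>2) (glue V\<^sub>1 (transport (Lines K\<^sub>1) \<psi>\<^sub>1 \<phi>\<^sub>2 \<iota>) V\<^sub>2)"
    (is "incidence_iso ?\<phi> ?\<psi> ?K ?V")
  unfolding incidence_iso_def
proof (intro conjI ballI)
  let ?\<iota> = "transport (Lines K\<^sub>1) \<psi>\<^sub>1 \<phi>\<^sub>2 \<iota>"
  have bij\<^sub>1: "bij_betw \<phi>\<^sub>1 (Points K\<^sub>1) (Points V\<^sub>1)" "bij_betw \<psi>\<^sub>1 (Lines K\<^sub>1) (Lines V\<^sub>1)"
    and bij\<^sub>2: "bij_betw \<phi>\<^sub>2 (Points K\<^sub>2) (Points V\<^sub>2)" "bij_betw \<psi>\<^sub>2 (Lines K\<^sub>2) (Lines V\<^sub>2)"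
    using iso\<^sub>1 iso\<^sub>2 by (auto simp: incidence_iso_def)
  have disjK: "Points K\<^sub>1 \<inter> Points K\<^sub>2 = {}" "Lines K\<^sub>1 \<inter> Lines K\<^sub>2 = {}"
    and incK: "incidence_structure K\<^sub>1" "incidence_structure K\<^sub>2"
    using g by (auto simp: glueable_def partial_linear_space_def)
  have "bij_betw ?\<phi> (Points K\<^sub>1) (Points V\<^sub>1)" "bij_betw ?\<psi> (Lines K\<^sub>1) (Lines V\<^sub>1)"
    using bij\<^sub>1 by (auto cong: bij_betw_cong)
  moreover have "bij_betw ?\<phi> (Points K\<^sub>2) (Points V\<^sub>2)"
    by (subst bij_betw_cong[of _ _ "\<phi>\<^sub>2"]) (use bij\<^sub>2 disjK in auto)
  moreover have "bij_betw ?\<psi> (Lines K\<^sub>2) (Lines V\<^sub>2)"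
    by (subst bij_betw_cong[of _ _ "\<psi>\<^sub>2"]) (use bij\<^sub>2 disjK in auto)
  ultimately show "bij_betw ?\<phi> (Points ?K) (Points ?V)" "bij_betw ?\<psi> (Lines ?K) (Lines ?V)"
    using disj by (auto simp: glue_def intro: bij_betw_combine)
  have mem: "\<phi>\<^sub>1 p \<in> Points V\<^sub>1" if "p \<in> Points K\<^sub>1" for p
    using bij\<^sub>1 that by (auto dest: bij_betwE)
  have mem2: "\<phi>\<^sub>2 p \<in> Points V\<^sub>2" if "p \<in> Points K\<^sub>2" for p
    using bij\<^sub>2 that by (auto dest: bij_betwE)
  have mel: "\<psi>\<^sub>1 A \<in> Lines V\<^sub>1" if "A \<in> Lines K\<^sub>1" for A
    using bij\<^sub>1 that by (auto dest: bij_betwE)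
  have mel2: "\<psi>\<^sub>2 A \<in> Lines V\<^sub>2" if "A \<in> Lines K\<^sub>2" for A
    using bij\<^sub>2 that by (auto dest: bij_betwE)
  have t: "?\<iota> (\<psi>\<^sub>1 A) = \<phi>\<^sub>2 (\<iota> A)" if "A \<in> Lines K\<^sub>1" for A
    using transport_apply[OF _ that] bij\<^sub>1 by (auto simp: bij_betw_def)
  have \<iota>: "\<iota> A \<in> Points K\<^sub>2" if "A \<in> Lines K\<^sub>1" for A
    using g that by (auto simp: glueable_def)
  have incK_iff: "(p, A) \<in> Inc ?K \<longleftrightarrow>
      (p, A) \<in> Inc K\<^sub>1 \<or> (p, A) \<in> Inc K\<^sub>2 \<or> A \<in> Lines K\<^sub>1 \<and> p = \<iota> A" for p A
    by (auto simp: glue_def)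
  have incV_iff: "(p, A) \<in> Inc ?V \<longleftrightarrow>
      (p, A) \<in> Inc V\<^sub>1 \<or> (p, A) \<in> Inc V\<^sub>2 \<or> A \<in> Lines V\<^sub>1 \<and> p = ?\<iota> A" for p A
    by (auto simp: glue_def)
  fix p A
  assume "p \<in> Points ?K" "A \<in> Lines ?K"
  then consider (11) "p \<in> Points K\<^sub>1" "A \<in> Lines K\<^sub>1" | (12) "p \<in> Points K\<^sub>1" "A \<in> Lines K\<^sub>2"
    | (21) "p \<in> Points K\<^sub>2" "A \<in> Lines K\<^sub>1" | (22) "p \<in> Points K\<^sub>2" "A \<in> Lines K\<^sub>2"
    by (auto simp: glue_def)
  then show "(p, A) \<in> Inc ?K \<longleftrightarrow> (?\<phi> p, ?\<psi> A) \<in> Inc ?V"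
  proof cases
    case 11
    \<comment> \<open>The pairs added by gluing have their point in the second component, so they do
      not meet this block.\<close>
    have "(p, A) \<in> Inc ?K \<longleftrightarrow> (p, A) \<in> Inc K\<^sub>1"
      unfolding incK_iff using 11 disjK incK \<iota>[of A] by (auto simp: incidence_structure_def)
    moreover have "(\<phi>\<^sub>1 p, \<psi>\<^sub>1 A) \<in> Inc ?V \<longleftrightarrow> (\<phi>\<^sub>1 p, \<psi>\<^sub>1 A) \<in> Inc V\<^sub>1"
      unfolding incV_iff
      using 11 disj inc mem[of p] mel[of A] mem2[OF \<iota>[of A]] t[of A]
      by (auto simp: incidence_structure_def)
    ultimately show ?thesis using 11 iso\<^sub>1 by (simp add: incidence_iso_def)
  next
    case 12
    \<comment> \<open>Gluing adds points only to lines of the first component, so this block is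
      empty on both sides.\<close>
    then have "(p, A) \<notin> Inc ?K"
      unfolding incK_iff using disjK incK by (auto simp: incidence_structure_def)
    moreover have "(\<phi>\<^sub>1 p, \<psi>\<^sub>2 A) \<notin> Inc ?V"
      unfolding incV_iff using 12 disj inc mem[of p] mel2[of A]
      by (auto simp: incidence_structure_def)
    ultimately show ?thesis using 12 disjK by auto
  next
    case 21
    have "(p, A) \<in> Inc ?K \<longleftrightarrow> p = \<iota> A"
      unfolding incK_iff using 21 disjK incK by (auto simp: incidence_structure_def)
    moreover have "(\<phi>\<^sub>2 p, \<psi>\<^sub>1 A) \<in> Inc ?V \<longleftrightarrow> \<phi>\<^sub>2 p = \<phi>\<^sub>2 (\<iota> A)"
      unfolding incV_iff using 21 disj inc mem2[of p] mel[of A] t[of A]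
      by (auto simp: incidence_structure_def)
    moreover have "\<phi>\<^sub>2 p = \<phi>\<^sub>2 (\<iota> A) \<longleftrightarrow> p = \<iota> A"
      using bij\<^sub>2 21 \<iota>[of A] by (auto simp: bij_betw_def inj_on_eq_iff)
    ultimately show ?thesis using 21 disjK by auto
  next
    case 22
    have "(p, A) \<in> Inc ?K \<longleftrightarrow> (p, A) \<in> Inc K\<^sub>2"
      unfolding incK_iff using 22 disjK incK by (auto simp: incidence_structure_def)
    moreover have "(\<phi>\<^sub>2 p, \<psi>\<^sub>2 A) \<in> Inc ?V \<longleftrightarrow> (\<phi>\<^sub>2 p, \<psi>\<^sub>2 A) \<in> Inc V\<^sub>2"
      unfolding incV_iff using 22 disj inc mem2[of p] mel2[of A]
      by (auto simp: incidence_structure_def)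
    moreover have "?\<phi> p = \<phi>\<^sub>2 p" "?\<psi> A = \<psi>\<^sub>2 A"
      using 22 disjK by auto
    ultimately show ?thesis using 22 iso\<^sub>2 by (simp add: incidence_iso_def)
  qed
qed

section \<open>Incidence in the Veronesian\<close>

lemma mem_msets_less: "e \<in> msets_less k X \<longleftrightarrow> set_mset e \<subseteq> X \<and> size e < k"
  by (auto simp: msets_less_def msets_def)

text \<open>The equation for \<open>f\<close> forces its support into \<open>X\<close> and, as
  \<open>size e < k\<close>, its size to be \<open>k\<close>.\<close>

lemma Inc_veronesian_iff:
  "(f, e) \<in> Inc (veronesian k X) \<longleftrightarrow>
    set_mset e \<subseteq> X \<and> size e < k \<and> (\<exists>x\<in>X. f = e + replicate_mset (k - size e) x)"
  by (auto simp: veronesian_def mem_msets_less msets_def)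

lemma incidence_structure_veronesian: "incidence_structure (veronesian k X)"
  by (auto simp: incidence_structure_def veronesian_def)

lemma incidence_structure_dual:
  "incidence_structure K \<Longrightarrow> incidence_structure (dual K)"
  by (auto simp: incidence_structure_def dual_def)

text \<open>The points are \<open>e\<close> times equal powers of some \<open>x\<close> and
  \<open>y\<close>. As \<open>p\<close> and \<open>q\<close> differ, so do \<open>x\<close> and
  \<open>y\<close>, and the powers have no common factor.\<close>

lemma veronesian_line_eq_inter:
  assumes "(p, e) \<in> Inc (veronesian k X)" and "(q, e) \<in> Inc (veronesian k X)" and "p \<noteq> q"
  shows "e = p \<inter># q"
proof -
  obtain x y where "p = e + replicate_mset (k - size e) x" "q = e + replicate_mset (k - size e) y"
    using assms(1,2) unfolding Inc_veronesian_iff by blast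
  with assms(3) show ?thesis by (auto simp: multiset_eq_iff)
qed

lemma partial_linear_space_veronesian: "partial_linear_space (veronesian k X)"
  unfolding partial_linear_space_def
  using incidence_structure_veronesian veronesian_line_eq_inter by metis

lemma dg_eq_count: "dg a f = count f a"
  unfolding dg_def
proof (rule Greatest_equality)
  show "\<exists>g. f = replicate_mset (count f a) a + g"
    by (metis count_le_replicate_mset_subset_eq order_refl subset_mset.le_iff_add)
qed auto

lemma infty_eq_filter: "infty a f = filter_mset (\<lambda>x. x \<noteq> a) f"
  unfolding infty_def dg_eq_count by (auto simp: multiset_eq_iff)

text \<open>Since \<open>f\<close> contains \<open>a\<close> and \<open>e\<close> does not, the
  element whose power completes \<open>e\<close> to \<open>f\<close> must be \<open>a\<close>. This
  describes the mixed block of the decomposition.\<close>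

lemma Inc_veronesian_infty:
  assumes f: "f \<in> msets k X" and a: "a \<in> set_mset f" and e: "a \<notin> set_mset e"
  shows "(f, e) \<in> Inc (veronesian k X) \<longleftrightarrow> e = infty a f"
proof
  assume "(f, e) \<in> Inc (veronesian k X)"
  then obtain x where x: "f = e + replicate_mset (k - size e) x"
    by (auto simp: Inc_veronesian_iff)
  with a e have "x = a" by (auto split: if_splits)
  with x e show "e = infty a f"
    by (auto simp: infty_eq_filter multiset_eq_iff not_in_iff)
next
  assume *: "e = infty a f"
  have f_eq: "f = e + replicate_mset (count f a) a"
    unfolding * infty_eq_filter by (auto simp: multiset_eq_iff)
  \<comment> \<open>This makes \<open>count f a\<close> the exponent \<open>k - size e\<close> that
    incidence prescribes; as \<open>a\<close> occurs in \<open>f\<close>, it is positive, whence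
    \<open>size e < k\<close>.\<close>
  have "k = size e + count f a"
    using arg_cong[OF f_eq, of size] f by (simp add: msets_def)
  moreover have "set_mset e \<subseteq> X" "a \<in> X"
    using f a * by (auto simp: infty_eq_filter msets_def)
  ultimately show "(f, e) \<in> Inc (veronesian k X)"
    using f_eq a by (auto simp: Inc_veronesian_iff intro!: bexI[of _ a])
qed

text \<open>Both sides have the same exponent, so the same \<open>x\<close> is a witness for
  each.\<close>

lemma Inc_veronesian_add_mset:
  assumes "a \<in> X"
  shows "(add_mset a f, add_mset a e) \<in> Inc (veronesian (Suc k) X) \<longleftrightarrow>
    (f, e) \<in> Inc (veronesian k X)"
  using assms by (auto simp: Inc_veronesian_iff)

text \<open>The inverse is \<open>add_mset a\<close>. Keeping \<open>A\<close> and \<open>B\<close>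
  abstract covers both the points and the lines of the Veronesian.\<close>

lemma bij_betw_remove1_mset:
  assumes "\<And>g. add_mset a g \<in> A \<longleftrightarrow> g \<in> B"
  shows "bij_betw (\<lambda>f. f - {#a#}) {f \<in> A. a \<in> set_mset f} B"
  by (rule bij_betw_byWitness[of _ "add_mset a"]) (use assms in \<open>auto simp flip: assms\<close>)

section \<open>Splitting the dual Veronesian at \<open>a\<close>\<close>

theorem proposition3p4:
  fixes X :: "'a set" and a :: 'a and m k :: nat
    and \<X>\<^sub>1 \<X>\<^sub>2 \<L>\<^sub>1 \<L>\<^sub>2 :: "'a multiset set"
    and K\<^sub>1 K\<^sub>2 :: "('a multiset, 'a multiset) incidence"
  assumes "finite X" and "card X = m" and "m \<ge> 1" and "k \<ge> 1" and "a \<in> X"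
    and "\<X>\<^sub>2 = {f \<in> msets k X. a \<in> set_mset f}"
    and "\<X>\<^sub>1 = msets k (X - {a})"
    and "\<L>\<^sub>2 = {e \<in> msets_less k X. a \<in> set_mset e}"
    and "\<L>\<^sub>1 = msets_less k (X - {a})"
    and "K\<^sub>2 = \<lparr>Points = \<L>\<^sub>2, Lines = \<X>\<^sub>2, Inc = (Inc (veronesian k X))\<inverse> \<inter> (\<L>\<^sub>2 \<times> \<X>\<^sub>2)\<rparr>"
    and "K\<^sub>1 = \<lparr>Points = \<L>\<^sub>1, Lines = \<X>\<^sub>1, Inc = (Inc (veronesian k X))\<inverse> \<inter> (\<L>\<^sub>1 \<times> \<X>\<^sub>1)\<rparr>"
  shows "glueable K\<^sub>2 (infty a) K\<^sub>1 \<and>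
    dual (veronesian k X) = glue K\<^sub>2 (infty a) K\<^sub>1 \<and>
    (\<exists>\<phi>\<^sub>2 \<psi>\<^sub>2 \<phi>\<^sub>1 \<psi>\<^sub>1.
       incidence_iso \<phi>\<^sub>2 \<psi>\<^sub>2 K\<^sub>2 (dual (veronesian (k - 1) X)) \<and>
       incidence_iso \<phi>\<^sub>1 \<psi>\<^sub>1 K\<^sub>1 (dual (veronesian k (X - {a}))) \<and>
       (let V\<^sub>2 = relabel Inl Inl (dual (veronesian (k - 1) X));
            V\<^sub>1 = relabel Inr Inr (dual (veronesian k (X - {a})));
            \<iota> = transport \<X>\<^sub>2 (Inl \<circ> \<psi>\<^sub>2) (Inr \<circ> \<phi>\<^sub>1) (infty a)
        in glueable V\<^sub>2 \<iota> V\<^sub>1 \<and>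
           incidence_iso
             (\<lambda>e. if e \<in> \<L>\<^sub>2 then Inl (\<phi>\<^sub>2 e) else Inr (\<phi>\<^sub>1 e))
             (\<lambda>f. if f \<in> \<X>\<^sub>2 then Inl (\<psi>\<^sub>2 f) else Inr (\<psi>\<^sub>1 f))
             (glue K\<^sub>2 (infty a) K\<^sub>1) (glue V\<^sub>2 \<iota> V\<^sub>1)))"
proof -
  let ?V = "veronesian k X"
  let ?\<phi> = "\<lambda>f. f - {#a#}"
  have PV: "Points ?V = msets k X" and LV: "Lines ?V = msets_less k X"
    by (auto simp: veronesian_def)
  \<comment> \<open>Index 2 marks the multisets containing \<open>a\<close>. Since
    \<open>K\<^sub>2\<close> is the first component of the gluing, indices run opposite to those in
    \<open>glueable\<close>.\<close>
  have mem\<^sub>1: "e \<in> \<L>\<^sub>1 \<longleftrightarrow> e \<in> msets_less k X \<and> a \<notin># e" "f \<in> \<X>\<^sub>1 \<longleftrightarrow> f \<in> msets k X \<and> a \<notin># f" for e f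
    unfolding assms by (auto simp: mem_msets_less msets_def)
  have mem\<^sub>2: "e \<in> \<L>\<^sub>2 \<longleftrightarrow> e \<in> msets_less k X \<and> a \<in># e" "f \<in> \<X>\<^sub>2 \<longleftrightarrow> f \<in> msets k X \<and> a \<in># f" for e f
    unfolding assms by auto
  \<comment> \<open>The uniqueness condition is symmetric in points and lines and survives
    restriction, so it is inherited from \<open>?V\<close>.\<close>
  have pls\<^sub>1: "partial_linear_space K\<^sub>1" and pls\<^sub>2: "partial_linear_space K\<^sub>2"
    using partial_linear_space_veronesian[of k X] mem\<^sub>1
    unfolding assms(6,8,10,11) partial_linear_space_def incidence_structure_def PV LV
    by (simp_all, blast+)
  have infty_mem: "infty a f \<in> \<L>\<^sub>1" if "f \<in> \<X>\<^sub>2" for f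
  proof -
    have "a \<notin># infty a f" by (auto simp: infty_eq_filter)
    then have "(f, infty a f) \<in> Inc ?V"
      using Inc_veronesian_infty[of f k X a "infty a f"] that unfolding assms(6) by auto
    with \<open>a \<notin># infty a f\<close> show ?thesis
      unfolding mem\<^sub>1 by (auto simp: Inc_veronesian_iff mem_msets_less)
  qed
  have inc_infty: "(f, e) \<in> Inc ?V \<longleftrightarrow> e = infty a f" if "f \<in> \<X>\<^sub>2" "e \<in> \<L>\<^sub>1" for e f
    using that Inc_veronesian_infty[of f k X a e] mem\<^sub>1 unfolding assms(6) by auto
  have "f = g" if "f \<in> \<X>\<^sub>2" "g \<in> \<X>\<^sub>2" "e \<in> \<L>\<^sub>2" "(f, e) \<in> Inc ?V" "(g, e) \<in> Inc ?V"
      "infty a f = infty a g" for e f g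
  proof (rule ccontr)
    assume "f \<noteq> g"
    moreover have "(f, infty a f) \<in> Inc ?V" "(g, infty a f) \<in> Inc ?V"
      using that inc_infty infty_mem by metis+
    \<comment> \<open>Both lines pass through the distinct points \<open>f\<close> and
      \<open>g\<close>, so both equal \<open>f \<inter># g\<close>; yet only \<open>e\<close>
      contains \<open>a\<close>.\<close>
    ultimately have "e = infty a f"
      using veronesian_line_eq_inter that by metis
    with that(3) show False unfolding assms(8) by (auto simp: infty_eq_filter)
  qed
  then have glueable: "glueable K\<^sub>2 (infty a) K\<^sub>1"
    using pls\<^sub>1 pls\<^sub>2 infty_mem mem\<^sub>1 unfolding glueable_def
    by (simp add: assms(10,11)) (auto simp: assms(6,8))
  \<comment> \<open>This excludes the block with \<open>a\<close> in the line but not in the point,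
    where gluing gives no incidence.\<close>
  have a_mono: "a \<in># f" if "(f, e) \<in> Inc ?V" "a \<in># e" for e f
    using that by (auto simp: Inc_veronesian_iff)
  have Inc_sub: "f \<in> msets k X \<and> e \<in> msets_less k X" if "(f, e) \<in> Inc ?V" for e f
    using that by (auto simp: veronesian_def)
  have glue: "dual ?V = glue K\<^sub>2 (infty a) K\<^sub>1"
  proof -
    have glue_iff: "(e, f) \<in> Inc (glue K\<^sub>2 (infty a) K\<^sub>1) \<longleftrightarrow>
        (f, e) \<in> Inc ?V \<and> (e \<in> \<L>\<^sub>2 \<and> f \<in> \<X>\<^sub>2 \<or> e \<in> \<L>\<^sub>1 \<and> f \<in> \<X>\<^sub>1) \<or> f \<in> \<X>\<^sub>2 \<and> e = infty a f" for e f
      by (auto simp: glue_def assms(10,11))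
    have "(f, e) \<in> Inc ?V \<longleftrightarrow> (e, f) \<in> Inc (glue K\<^sub>2 (infty a) K\<^sub>1)" for e f
    proof
      assume I: "(f, e) \<in> Inc ?V"
      then have "e \<in> \<L>\<^sub>2 \<and> f \<in> \<X>\<^sub>2 \<or> e \<in> \<L>\<^sub>1 \<and> f \<in> \<X>\<^sub>1 \<or> e \<in> \<L>\<^sub>1 \<and> f \<in> \<X>\<^sub>2"
        using Inc_sub[OF I] a_mono[OF I] mem\<^sub>1 mem\<^sub>2 by blast
      with I show "(e, f) \<in> Inc (glue K\<^sub>2 (infty a) K\<^sub>1)"
        unfolding glue_iff using inc_infty by blast
    next
      assume "(e, f) \<in> Inc (glue K\<^sub>2 (infty a) K\<^sub>1)"
      then show "(f, e) \<in> Inc ?V"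
        unfolding glue_iff using inc_infty infty_mem by blast
    qed
    then have "(Inc ?V)\<inverse> = Inc (glue K\<^sub>2 (infty a) K\<^sub>1)" by auto
    moreover have "Lines ?V = \<L>\<^sub>2 \<union> \<L>\<^sub>1" "Points ?V = \<X>\<^sub>2 \<union> \<X>\<^sub>1"
      using mem\<^sub>1 unfolding PV LV by (auto simp: assms(6,8))
    ultimately show ?thesis
      unfolding dual_def by (simp add: glue_def assms(10,11))
  qed
  \<comment> \<open>Used in folded form below, to apply the cancellation of one \<open>a\<close>
    between levels \<open>k\<close> and \<open>k - 1\<close>.\<close>
  have k: "k = Suc (k - 1)" using assms(4) by simp
  have iso\<^sub>2: "incidence_iso ?\<phi> ?\<phi> K\<^sub>2 (dual (veronesian (k - 1) X))"
    unfolding incidence_iso_def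
  proof (intro conjI ballI)
    show "bij_betw ?\<phi> (Points K\<^sub>2) (Points (dual (veronesian (k - 1) X)))"
      unfolding assms(10) assms(8)
      by (simp add: dual_def veronesian_def, rule bij_betw_remove1_mset)
        (use \<open>a \<in> X\<close> in \<open>auto simp: mem_msets_less\<close>)
    show "bij_betw ?\<phi> (Lines K\<^sub>2) (Lines (dual (veronesian (k - 1) X)))"
      unfolding assms(10) assms(6)
      by (simp add: dual_def veronesian_def, rule bij_betw_remove1_mset)
        (use \<open>a \<in> X\<close> \<open>k \<ge> 1\<close> in \<open>auto simp: msets_def\<close>)
    fix e f
    assume ef: "e \<in> Points K\<^sub>2" "f \<in> Lines K\<^sub>2"
    then obtain e' f' where "e = add_mset a e'" "f = add_mset a f'"
      unfolding assms(6,8,10) by (auto dest!: multi_member_split)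
    then show "(e, f) \<in> Inc K\<^sub>2 \<longleftrightarrow> (?\<phi> e, ?\<phi> f) \<in> Inc (dual (veronesian (k - 1) X))"
      using ef Inc_veronesian_add_mset[OF \<open>a \<in> X\<close>, of f' e' "k - 1", folded k]
      by (auto simp: assms(10) dual_def)
  qed
  \<comment> \<open>The exponent \<open>k - size e\<close> is positive, so the witness
    \<open>x\<close> occurs in \<open>f\<close> and differs from \<open>a\<close> when
    \<open>f\<close> avoids \<open>a\<close>. Hence \<open>K\<^sub>1\<close> is literally the dual
    of the smaller Veronesian, and \<open>id\<close> serves as isomorphism.\<close>
  have "(f, e) \<in> Inc ?V \<and> e \<in> \<L>\<^sub>1 \<and> f \<in> \<X>\<^sub>1 \<longleftrightarrow> (f, e) \<in> Inc (veronesian k (X - {a}))" for e f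
    unfolding Inc_veronesian_iff assms(7,9)
    by (auto simp: mem_msets_less msets_def)
  then have "(Inc ?V)\<inverse> \<inter> (\<L>\<^sub>1 \<times> \<X>\<^sub>1) = (Inc (veronesian k (X - {a})))\<inverse>"
    by auto
  moreover have "\<L>\<^sub>1 = Lines (veronesian k (X - {a}))" "\<X>\<^sub>1 = Points (veronesian k (X - {a}))"
    by (simp_all add: assms(7,9) veronesian_def)
  ultimately have K\<^sub>1: "K\<^sub>1 = dual (veronesian k (X - {a}))"
    unfolding assms(11) dual_def by simp
  have iso\<^sub>1: "incidence_iso id id K\<^sub>1 (dual (veronesian k (X - {a})))"
    unfolding K\<^sub>1 by (simp add: incidence_iso_def)
  \<comment> \<open>Tagging by \<open>Inl\<close> and \<open>Inr\<close> gives disjoint copies; for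
    \<open>k \<ge> 2\<close> the two duals themselves share the point \<open>{#}\<close>.\<close>
  define V\<^sub>2 :: "('a multiset + 'a multiset, 'a multiset + 'a multiset) incidence"
    where "V\<^sub>2 = relabel Inl Inl (dual (veronesian (k - 1) X))"
  define V\<^sub>1 :: "('a multiset + 'a multiset, 'a multiset + 'a multiset) incidence"
    where "V\<^sub>1 = relabel Inr Inr (dual (veronesian k (X - {a})))"
  have V\<^sub>2: "incidence_iso (Inl \<circ> ?\<phi>) (Inl \<circ> ?\<phi>) K\<^sub>2 V\<^sub>2"
    unfolding V\<^sub>2_def by (intro incidence_iso_comp[OF iso\<^sub>2] incidence_iso_relabel) auto
  have V\<^sub>1: "incidence_iso (Inr \<circ> id) (Inr \<circ> id) K\<^sub>1 V\<^sub>1"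
    unfolding V\<^sub>1_def by (intro incidence_iso_comp[OF iso\<^sub>1] incidence_iso_relabel) auto
  have inc: "incidence_structure V\<^sub>2" "incidence_structure V\<^sub>1"
    unfolding V\<^sub>1_def V\<^sub>2_def
    by (intro incidence_structure_relabel incidence_structure_dual incidence_structure_veronesian)+
  have disj: "Points V\<^sub>2 \<inter> Points V\<^sub>1 = {}" "Lines V\<^sub>2 \<inter> Lines V\<^sub>1 = {}"
    by (auto simp: V\<^sub>1_def V\<^sub>2_def relabel_def)
  have K\<^sub>2: "Points K\<^sub>2 = \<L>\<^sub>2" "Lines K\<^sub>2 = \<X>\<^sub>2" by (simp_all add: assms(10))
  note transported = glueable_transport[OF glueable V\<^sub>2 V\<^sub>1 inc disj, unfolded K\<^sub>2]
    incidence_iso_glue[OF glueable V\<^sub>2 V\<^sub>1 inc disj, unfolded K\<^sub>2]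
  \<comment> \<open>The witnesses are \<open>?\<phi>\<close> for both maps on
    \<open>K\<^sub>2\<close> and \<open>id\<close> for both on \<open>K\<^sub>1\<close>; unfolding
    the compositions aligns the transported facts with the goal.\<close>
  show ?thesis
    unfolding Let_def comp_def
    using glueable glue iso\<^sub>1 iso\<^sub>2 transported[unfolded V\<^sub>1_def V\<^sub>2_def o_apply] by blast
qed

end
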